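(* Let $T$ be a $V$-semiring with respect to the triple $(K,v,M)$, where $K$ is a semifield and $v:K\to M_\infty$ is surjective, and write $S_v=\{s\in K: v(s)\geq 0\}=T$. Then for any cyclic $S_v$-subsemimodules $L_1,L_2$ of the $S_v$-semimodule $K$, either $L_1\subseteq L_2$ or $L_2\subseteq L_1$. In particular, for any principal ideals $J_1,J_2$ of the semiring $S_v$, either $J_1\subseteq J_2$ or $J_2\subseteq J_1$.
   Context: All semirings are commutative, with a zero $0$ (absorbing for multiplication) and an identity $1\neq 0$. A semifield is such a semiring in which every nonzero element is multiplicatively invertible. $K$ is regarded as a semimodule over its subsemiring $S_v$ by multiplication. The cyclic $S_v$-subsemimodule of $K$ generated by $x\in K$ is $(x)=\{sx: s\in S_v\}$. The principal ideal of $S_v$ generated by $x\in S_v$ is $(x)=\{sx:s\in S_v\}$. A tomonoid $(M,+,0,\leq)$ is a commutative monoid $(M,+,0)$ with a total order $\leq$ such that $x\leq y$ implies $x+z\leq y+z$ for all $z\in M$. For a tomonoid $M$ with no greatest element, $M_\infty = M\cup\{+\infty\}$ is the tomonoid obtained by adjoining an element $+\infty$ with $m<+\infty$ for all $m\in M$ and $m+(+\infty)=(+\infty)+m=+\infty$ for all $m\in M_\infty$. An $M$-valuation on a semiring $S$ is a map $v:S\to M_\infty$, where $M$ is a tomonoid with no greatest element, such that $v(xy)=v(x)+v(y)$ and $v(x+y)\geq\min\{v(x),v(y)\}$ for all $x,y\in S$, $v(1)=0$ and $v(0)=+\infty$. A semiring $T$ is a $V$-semiring with respect to the triple $(S,v,M)$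 if $v$ is an $M$-valuation on the semiring $S$, $S$ contains $T$ as a subsemiring, and $T=\{s\in S: v(s)\geq 0\}$. *)

theory Defs
  imports Main
begin

class semifield = comm_semiring_1 +
  assumes nonzero_invertible: "x \<noteq> 0 \<Longrightarrow> \<exists>y. x * y = 1"

class tomonoid = linorder + ordered_comm_monoid_add

datatype 'm adjoin_infty = Fin 'm | Infty

instantiation adjoin_infty :: (tomonoid) tomonoid
begin

definition zero_adjoin_infty :: "'a adjoin_infty" where
  "0 = Fin 0"

fun plus_adjoin_infty :: "'a adjoin_infty \<Rightarrow> 'a adjoin_infty \<Rightarrow> 'a adjoin_infty" where
  "Fin a + Fin b = Fin (a + b)"
| "Fin _ + Infty = Infty"
| "Infty + _ = Infty"

fun less_eq_adjoin_infty :: "'a adjoin_infty \<Rightarrow> 'a adjoin_infty \<Rightarrow> bool" where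
  "Fin a \<le> Fin b \<longleftrightarrow> a \<le> b"
| "_ \<le> Infty \<longleftrightarrow> True"
| "Infty \<le> Fin _ \<longleftrightarrow> False"

definition less_adjoin_infty :: "'a adjoin_infty \<Rightarrow> 'a adjoin_infty \<Rightarrow> bool" where
  "a < b \<longleftrightarrow> a \<le> b \<and> \<not> b \<le> (a :: 'a adjoin_infty)"

instance
proof
  fix a b c :: "'a adjoin_infty"
  show "a + b + c = a + (b + c)"
    by (cases a; cases b; cases c) (simp_all add: add.assoc)
  show "a + b = b + a"
    by (cases a; cases b) (simp_all add: add.commute)
  show "0 + a = a"
    by (cases a) (simp_all add: zero_adjoin_infty_def)
  show "a < b \<longleftrightarrow> a \<le> b \<and> \<not> b \<le> a"
    by (rule less_adjoin_infty_def)
  show "a \<le> a"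
    by (cases a) simp_all
  show "a \<le> b \<Longrightarrow> b \<le> c \<Longrightarrow> a \<le> c"
    by (cases a; cases b; cases c) simp_all
  show "a \<le> b \<Longrightarrow> b \<le> a \<Longrightarrow> a = b"
    by (cases a; cases b) simp_all
  show "a \<le> b \<or> b \<le> a"
    by (cases a; cases b) (simp_all add: linear)
  show "a \<le> b \<Longrightarrow> c + a \<le> c + b"
    by (cases a; cases b; cases c) (simp_all add: add_left_mono)
qed

end

text \<open>In a linear order, class \<^class>\<open>no_top\<close> says that there is no greatest element.\<close>

definition valuation ::
    "('s::comm_semiring_1 \<Rightarrow> 'm::{tomonoid, no_top} adjoin_infty) \<Rightarrow> bool" where
  "valuation v \<longleftrightarrow>
     (\<forall>x y. v (x * y) = v x + v y) \<and>
     (\<forall>x y. v (x + y) \<ge> min (v x) (v y)) \<and>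
     v 1 = 0 \<and> v 0 = Infty"

definition nonneg_part :: "('s::comm_semiring_1 \<Rightarrow> 'm::tomonoid adjoin_infty) \<Rightarrow> 's set" where
  "nonneg_part v = {s. v s \<ge> 0}"

definition subsemiring :: "'s::comm_semiring_1 set \<Rightarrow> bool" where
  "subsemiring R \<longleftrightarrow>
     0 \<in> R \<and> 1 \<in> R \<and> (\<forall>x\<in>R. \<forall>y\<in>R. x + y \<in> R) \<and> (\<forall>x\<in>R. \<forall>y\<in>R. x * y \<in> R)"

text \<open>The semiring \<open>S\<close> and the tomonoid \<open>M\<close> of a triple \<open>(S, v, M)\<close> are the types
  \<open>'s\<close> and \<open>'m\<close>.\<close>

definition V_semiring ::
    "'s::comm_semiring_1 set \<Rightarrow> ('s \<Rightarrow> 'm::{tomonoid, no_top} adjoin_infty) \<Rightarrow> bool" where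
  "V_semiring T v \<longleftrightarrow> valuation v \<and> subsemiring T \<and> T = nonneg_part v"

definition multiples :: "'s::comm_semiring_1 set \<Rightarrow> 's \<Rightarrow> 's set" where
  "multiples R x = {s * x | s. s \<in> R}"

text \<open>For a subsemiring \<open>R\<close>, the ambient semiring is an \<open>R\<close>-semimodule by multiplication.
  Generators of cyclic subsemimodules range over the whole ambient semiring, whereas generators
  of principal ideals of \<open>R\<close> must lie in \<open>R\<close>.\<close>

definition cyclic_subsemimodule :: "'s::comm_semiring_1 set \<Rightarrow> 's set \<Rightarrow> bool" where
  "cyclic_subsemimodule R L \<longleftrightarrow> (\<exists>x. L = multiples R x)"

definition principal_ideal :: "'s::comm_semiring_1 set \<Rightarrow> 's set \<Rightarrow> bool" where
  "principal_ideal R J \<longleftrightarrow> (\<exists>x\<in>R. J = multiples R x)"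

end

theory Submission
  imports Defs
begin

text \<open>
  Inclusion of cyclic subsemimodules is divisibility: the multiples of \<open>x\<close> lie among those of
  \<open>y\<close> as soon as \<open>x = c * y\<close> with \<open>c\<close> in the subsemiring. In a semifield two nonzero elements
  always satisfy \<open>x = c * y\<close> and \<open>y = d * x\<close> for mutually inverse \<open>c\<close> and \<open>d\<close>, and then
  \<open>v c + v d = v 1 = 0\<close>. Two negative elements of a tomonoid have a negative sum, so \<open>c\<close> or \<open>d\<close>
  has nonnegative value (\<open>nonneg_part_inverse_cases\<close>), which gives one of the two inclusions.
  Principal ideals are the cyclic subsemimodules with a generator in the subsemiring, so their
  case is a special one.
\<close>

lemma multiples_mono:
  assumes "subsemiring R" and "c \<in> R" and "x = c * y"
  shows "multiples R x \<subseteq> multiples R y"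
proof
  fix z assume "z \<in> multiples R x"
  then obtain s where "s \<in> R" "z = s * x"
    by (auto simp: multiples_def)
  then have "s * c \<in> R" "z = (s * c) * y"
    using assms by (auto simp: subsemiring_def mult.assoc)
  then show "z \<in> multiples R y"
    by (auto simp: multiples_def)
qed

text \<open>
  If both values were negative, then adding \<open>v c\<close> to \<open>v d \<le> 0\<close> would give \<open>0 \<le> v c\<close>. Addition
  in a tomonoid need not be strictly monotone, so strictness has to come from \<open>v c < 0\<close> alone.
\<close>

lemma nonneg_part_inverse_cases:
  assumes "valuation v" and "c * d = 1"
  shows "c \<in> nonneg_part v \<or> d \<in> nonneg_part v"
proof (rule ccontr)
  assume "\<not> ?thesis"
  then have "v c < 0" "v d \<le> 0"
    by (auto simp: nonneg_part_def)
  have "0 = v c + v d"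
    using assms by (metis valuation_def)
  also have "\<dots> \<le> v c + 0"
    using \<open>v d \<le> 0\<close> by (rule add_left_mono)
  finally show False
    using \<open>v c < 0\<close> by simp
qed

lemma multiples_nonneg_part_linear:
  fixes v :: "'k::semifield \<Rightarrow> 'm::{tomonoid, no_top} adjoin_infty"
  assumes val: "valuation v" and sub: "subsemiring (nonneg_part v)"
  shows "multiples (nonneg_part v) x \<subseteq> multiples (nonneg_part v) y \<or>
         multiples (nonneg_part v) y \<subseteq> multiples (nonneg_part v) x"
proof (cases "x = 0 \<or> y = 0")
  case True
  \<comment> \<open>The zero module is contained in every cyclic one, since \<open>0 = 0 * y\<close>.\<close>
  have "0 \<in> nonneg_part v"
    using sub by (simp add: subsemiring_def)
  then show ?thesis
    using True multiples_mono[OF sub, of 0] by auto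
next
  case False
  then obtain x' y' where x': "x * x' = 1" and y': "y * y' = 1"
    using nonzero_invertible by meson
  have "(x * y') * (y * x') = (x * x') * (y * y')"
    by (simp add: ac_simps)
  then have "(x * y') * (y * x') = 1"
    by (simp add: x' y')
  then have "x * y' \<in> nonneg_part v \<or> y * x' \<in> nonneg_part v"
    by (rule nonneg_part_inverse_cases[OF val])
  moreover have "x = (x * y') * y" "y = (y * x') * x"
    using x' y' by (simp_all add: mult.assoc mult.commute[of y'] mult.commute[of x'])
  ultimately show ?thesis
    using multiples_mono[OF sub] by blast
qed

theorem proposition2p18:
  fixes T :: "'k::semifield set"
    and v :: "'k \<Rightarrow> 'm::{tomonoid, no_top} adjoin_infty"
  assumes "V_semiring T v"
    and "surj v"
  shows "(\<forall>L1 L2. cyclic_subsemimodule (nonneg_part v) L1 \<longrightarrow>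
            cyclic_subsemimodule (nonneg_part v) L2 \<longrightarrow> L1 \<subseteq> L2 \<or> L2 \<subseteq> L1) \<and>
         (\<forall>J1 J2. principal_ideal (nonneg_part v) J1 \<longrightarrow>
            principal_ideal (nonneg_part v) J2 \<longrightarrow> J1 \<subseteq> J2 \<or> J2 \<subseteq> J1)"
proof -
  have "valuation v" "subsemiring (nonneg_part v)"
    using assms(1) by (auto simp: V_semiring_def)
  note linear = multiples_nonneg_part_linear[OF this]
  show ?thesis
    unfolding cyclic_subsemimodule_def principal_ideal_def using linear by blast
qed

end
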